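(* Let $\mathfrak{g}$ be one of the Com-PreLie algebras $\mathfrak{g}^{(1)}(N,\lambda,a,b)$, $\mathfrak{g}^{(2)}(N,\lambda,\mu)$, $\mathfrak{g}^{(3)}(N,\lambda,\mu)$, $\mathfrak{g}^{(4)}(\lambda)$ on $\mathbb{K}[X]$ described in the context, and let $\mathfrak{g}_+=\mathrm{Vect}(X^k,k\geq1)$ be its augmentation ideal, seen as a Lie algebra with $[x,y]=x\bullet y-y\bullet x$. 1. If $\mathfrak{g}=\mathfrak{g}^{(1)}(N,\lambda,a,b)$ or $\mathfrak{g}^{(3)}(N,\lambda,\mu)$ then, as a Lie algebra, \[\mathfrak{g}_+\approx\left(V_{\frac1N}\oplus\ldots\oplus V_{\frac{N-1}N}\right)\oplus_\tau\mathfrak{g}_{FdB}.\] 2. If $\mathfrak{g}=\mathfrak{g}^{(2)}(N,\lambda,\mu)$, let $\mathfrak{g}_1$ be the abelian Lie algebra with basis $(f_k)_{k\geq1,\,k\neq N}$, and let $\tau$ be the (right) action of the one-dimensional Lie algebra $\mathbb{K}$ on $\mathfrak{g}_1$ given by $f_k\cdot1=f_{k+N}$ for any $k$. Then, as a Lie algebra, $\mathfrak{g}_+\approx\mathfrak{g}_1\oplus_\tau\mathbb{K}$. 3. If $\mathfrak{g}=\mathfrak{g}^{(4)}(\lambda)$, then $\mathfrak{g}_+$ is abelian.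
   Context: $\mathbb{K}$ is a field of characteristic zero. The Com-PreLie algebras are $\mathbb{K}[X]$ with its usual product and the pre-Lie product $\bullet$ given, for $i,j\in\mathbb{N}$, by $X^i\bullet1=i\lambda X^i$ in all cases, and for $j\geq1$: in $\mathfrak{g}^{(1)}(N,\lambda,a,b)$ ($N\geq1$, $\lambda,a,b\in\mathbb{K}$, $a\neq0$, $b$ not a strictly negative integer), $X^i\bullet X^j=\frac{ai}{\frac jN+b}X^{i+j}$ if $N\mid j$, $0$ otherwise; in $\mathfrak{g}^{(2)}(N,\lambda,\mu)$ ($N\geq1$, $\lambda,\mu\in\mathbb{K}$, $\mu\neq0$), $X^i\bullet X^j=i\mu X^{i+N}$ if $j=N$, $0$ otherwise; in $\mathfrak{g}^{(3)}(N,\lambda,\mu)$ ($N\geq1$, $\lambda,\mu\in\mathbb{K}$, $\mu\neq0$), $X^i\bullet X^j=i\mu X^{i+j}$ if $N\mid j$, $0$ otherwise; in $\mathfrak{g}^{(4)}(\lambda)$ ($\lambda\in\mathbb{K}$), $X^i\bullet X^j=0$. $\mathfrak{g}_{FdB}$ (Faà di Bruno Lie algebra) has basis $(e_i)_{i\geq1}$ and bracket $[e_k,e_l]=(k-l)e_{k+l}$. For $c\in\mathbb{K}$, $V_c$ is the right $\mathfrak{g}_{FdB}$-module with basis $(f_k)_{k\in\mathbb{N}}$ and $f_k\cdot e_l=(k+c)f_{k+l}$ for $k\geq 0$, $l\geq1$. If $\mathfrak{h}$ is a Lie algebra and $M$ a right $\mathfrak{h}$-module, $M\oplus_\tau\mathfrak{h}$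 is the vector space $M\oplus\mathfrak{h}$ with bracket $[x+y,x'+y']=x\cdot y'-x'\cdot y+[y,y']$ for $x,x'\in M$, $y,y'\in\mathfrak{h}$ (so $M$ is an abelian ideal). For $N=1$ the sum of modules in item 1 is $(0)$. *)

theory Defs
  imports
    "HOL-Computational_Algebra.Polynomial"
    "HOL-Library.Poly_Mapping"
    "HOL-Library.Product_Plus"
begin

section \<open>Lie algebras, right modules and semidirect sums\<close>

text \<open>A Lie algebra lives on a subspace \<open>lspace L\<close> of a vector space given by a type of class
  \<open>ab_group_add\<close> and the scalar multiplication \<open>lscale L\<close>; the values of the bracket outside
  \<open>lspace L\<close> are irrelevant.\<close>

record ('k, 'v) lie_alg =
  lspace :: "'v set"
  lscale :: "'k \<Rightarrow> 'v \<Rightarrow> 'v"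
  lbracket :: "'v \<Rightarrow> 'v \<Rightarrow> 'v"

locale lie_algebra =
  fixes L :: "('k :: field, 'v :: ab_group_add) lie_alg"
  assumes vector_space: "vector_space (lscale L)"
    and subspace: "module.subspace (lscale L) (lspace L)"
    and bracket_closed: "\<lbrakk>x \<in> lspace L; y \<in> lspace L\<rbrakk> \<Longrightarrow> lbracket L x y \<in> lspace L"
    and bracket_add_left: "\<lbrakk>x \<in> lspace L; y \<in> lspace L; z \<in> lspace L\<rbrakk> \<Longrightarrow>
      lbracket L (x + y) z = lbracket L x z + lbracket L y z"
    and bracket_add_right: "\<lbrakk>x \<in> lspace L; y \<in> lspace L; z \<in> lspace L\<rbrakk> \<Longrightarrow>
      lbracket L x (y + z) = lbracket L x y + lbracket L x z"
    and bracket_scale_left: "\<lbrakk>x \<in> lspace L; y \<in> lspace L\<rbrakk> \<Longrightarrow>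
      lbracket L (lscale L c x) y = lscale L c (lbracket L x y)"
    and bracket_scale_right: "\<lbrakk>x \<in> lspace L; y \<in> lspace L\<rbrakk> \<Longrightarrow>
      lbracket L x (lscale L c y) = lscale L c (lbracket L x y)"
    and bracket_self: "x \<in> lspace L \<Longrightarrow> lbracket L x x = 0"
    and jacobi: "\<lbrakk>x \<in> lspace L; y \<in> lspace L; z \<in> lspace L\<rbrakk> \<Longrightarrow>
      lbracket L x (lbracket L y z) + lbracket L y (lbracket L z x)
        + lbracket L z (lbracket L x y) = 0"

definition abelian_lie_algebra :: "('k :: field, 'v :: ab_group_add) lie_alg \<Rightarrow> bool" where
  "abelian_lie_algebra L \<longleftrightarrow>
     lie_algebra L \<and> (\<forall>x\<in>lspace L. \<forall>y\<in>lspace L. lbracket L x y = 0)"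

definition lie_iso ::
  "('v \<Rightarrow> 'w) \<Rightarrow> ('k :: field, 'v :: ab_group_add) lie_alg \<Rightarrow> ('k, 'w :: ab_group_add) lie_alg \<Rightarrow> bool"
where
  "lie_iso \<phi> L M \<longleftrightarrow>
     bij_betw \<phi> (lspace L) (lspace M) \<and>
     (\<forall>x\<in>lspace L. \<forall>y\<in>lspace L. \<phi> (x + y) = \<phi> x + \<phi> y) \<and>
     (\<forall>c. \<forall>x\<in>lspace L. \<phi> (lscale L c x) = lscale M c (\<phi> x)) \<and>
     (\<forall>x\<in>lspace L. \<forall>y\<in>lspace L. \<phi> (lbracket L x y) = lbracket M (\<phi> x) (\<phi> y))"

text \<open>Isomorphism includes that both sides really are Lie algebras.\<close>

definition lie_isomorphic ::
  "('k :: field, 'v :: ab_group_add) lie_alg \<Rightarrow> ('k, 'w :: ab_group_add) lie_alg \<Rightarrow> bool"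
  (infix "\<simeq>\<^sub>L" 50)
where
  "L \<simeq>\<^sub>L M \<longleftrightarrow> lie_algebra L \<and> lie_algebra M \<and> (\<exists>\<phi>. lie_iso \<phi> L M)"

record ('k, 'm, 'h) right_mod =
  mspace :: "'m set"
  mscale :: "'k \<Rightarrow> 'm \<Rightarrow> 'm"
  mact :: "'m \<Rightarrow> 'h \<Rightarrow> 'm"

text \<open>The elements of a direct sum are the finitely supported families.\<close>

definition module_sum ::
  "'i set \<Rightarrow> ('i \<Rightarrow> ('k, 'm :: ab_group_add, 'h) right_mod) \<Rightarrow> ('k, 'i \<Rightarrow>\<^sub>0 'm, 'h) right_mod"
where
  "module_sum I M =
     \<lparr>mspace = {F. Poly_Mapping.keys F \<subseteq> I \<and> (\<forall>i\<in>I. Poly_Mapping.lookup F i \<in> mspace (M i))},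
      mscale = (\<lambda>c. Poly_Mapping.mapp (\<lambda>i. mscale (M i) c)),
      mact = (\<lambda>F y. Poly_Mapping.mapp (\<lambda>i m. mact (M i) m y) F)\<rparr>"

text \<open>The module \<open>M\<close> is an abelian ideal of \<open>M \<oplus>\<^sub>\<tau> H\<close>. The Jacobi identity in
  \<open>M \<oplus>\<^sub>\<tau> H\<close> contains the axiom \<open>x \<cdot> [y, y'] = (x \<cdot> y) \<cdot> y' - (x \<cdot> y') \<cdot> y\<close> of a right module.\<close>

definition semidirect ::
  "('k, 'm :: ab_group_add, 'h :: ab_group_add) right_mod \<Rightarrow> ('k, 'h) lie_alg \<Rightarrow>
   ('k, 'm \<times> 'h) lie_alg" (infix "\<oplus>\<^sub>\<tau>" 65)
where
  "M \<oplus>\<^sub>\<tau> H =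
     \<lparr>lspace = mspace M \<times> lspace H,
      lscale = (\<lambda>c (x, y). (mscale M c x, lscale H c y)),
      lbracket = (\<lambda>(x, y) (x', y'). (mact M x y' - mact M x' y, lbracket H y y'))\<rparr>"

section \<open>The Faa di Bruno Lie algebra and its modules\<close>

text \<open>The vector space with basis \<open>I\<close> is the set of finitely supported functions with keys in
  \<open>I\<close>; the basis vector of index \<open>i\<close> is \<open>Poly_Mapping.single i 1\<close>.\<close>

definition free_scale :: "'k :: field \<Rightarrow> ('i \<Rightarrow>\<^sub>0 'k) \<Rightarrow> ('i \<Rightarrow>\<^sub>0 'k)" where
  "free_scale c = Poly_Mapping.map ((*) c)"

definition free_bilinear ::
  "('i \<Rightarrow> 'j \<Rightarrow> ('l \<Rightarrow>\<^sub>0 'k)) \<Rightarrow> ('i \<Rightarrow>\<^sub>0 'k) \<Rightarrow> ('j \<Rightarrow>\<^sub>0 'k) \<Rightarrow> ('l \<Rightarrow>\<^sub>0 'k :: field)"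
where
  "free_bilinear B x y =
     (\<Sum>i\<in>Poly_Mapping.keys x. \<Sum>j\<in>Poly_Mapping.keys y.
        free_scale (Poly_Mapping.lookup x i * Poly_Mapping.lookup y j) (B i j))"

definition FdB :: "('k :: field_char_0, nat \<Rightarrow>\<^sub>0 'k) lie_alg" where
  "FdB =
     \<lparr>lspace = {x. Poly_Mapping.keys x \<subseteq> {1..}},
      lscale = free_scale,
      lbracket = free_bilinear (\<lambda>k l. Poly_Mapping.single (k + l) (of_nat k - of_nat l))\<rparr>"

definition FdB_module ::
  "'k :: field_char_0 \<Rightarrow> ('k, nat \<Rightarrow>\<^sub>0 'k, nat \<Rightarrow>\<^sub>0 'k) right_mod" where
  "FdB_module c =
     \<lparr>mspace = UNIV,
      mscale = free_scale,
      mact = free_bilinear (\<lambda>k l. Poly_Mapping.single (k + l) (of_nat k + c))\<rparr>"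

section \<open>The one-dimensional Lie algebra and its shift module\<close>

definition line_lie :: "('k :: field_char_0, 'k) lie_alg" where
  "line_lie = \<lparr>lspace = UNIV, lscale = (*), lbracket = (\<lambda>_ _. 0)\<rparr>"

definition shift_module :: "nat \<Rightarrow> ('k :: field_char_0, nat \<Rightarrow>\<^sub>0 'k, 'k) right_mod" where
  "shift_module N =
     \<lparr>mspace = {x. Poly_Mapping.keys x \<subseteq> {1..} - {N}},
      mscale = free_scale,
      mact = (\<lambda>x t. \<Sum>k\<in>Poly_Mapping.keys x.
        free_scale (Poly_Mapping.lookup x k * t) (Poly_Mapping.single (k + N) 1))\<rparr>"

section \<open>The pre-Lie products on polynomials\<close>

definition poly_bilinear ::
  "(nat \<Rightarrow> nat \<Rightarrow> 'k :: field poly) \<Rightarrow> 'k poly \<Rightarrow> 'k poly \<Rightarrow> 'k poly" where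
  "poly_bilinear B p q =
     (\<Sum>i\<le>degree p. \<Sum>j\<le>degree q. smult (coeff p i * coeff q j) (B i j))"

definition prelie1 ::
  "nat \<Rightarrow> 'k :: field_char_0 \<Rightarrow> 'k \<Rightarrow> 'k \<Rightarrow> 'k poly \<Rightarrow> 'k poly \<Rightarrow> 'k poly" where
  "prelie1 N lam a b = poly_bilinear (\<lambda>i j.
     if j = 0 then monom (of_nat i * lam) i
     else if N dvd j then monom (a * of_nat i / (of_nat j / of_nat N + b)) (i + j)
     else 0)"

definition prelie2 ::
  "nat \<Rightarrow> 'k :: field_char_0 \<Rightarrow> 'k \<Rightarrow> 'k poly \<Rightarrow> 'k poly \<Rightarrow> 'k poly" where
  "prelie2 N lam mu = poly_bilinear (\<lambda>i j.
     if j = 0 then monom (of_nat i * lam) i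
     else if j = N then monom (of_nat i * mu) (i + N)
     else 0)"

definition prelie3 ::
  "nat \<Rightarrow> 'k :: field_char_0 \<Rightarrow> 'k \<Rightarrow> 'k poly \<Rightarrow> 'k poly \<Rightarrow> 'k poly" where
  "prelie3 N lam mu = poly_bilinear (\<lambda>i j.
     if j = 0 then monom (of_nat i * lam) i
     else if N dvd j then monom (of_nat i * mu) (i + j)
     else 0)"

definition prelie4 :: "'k :: field_char_0 \<Rightarrow> 'k poly \<Rightarrow> 'k poly \<Rightarrow> 'k poly" where
  "prelie4 lam = poly_bilinear (\<lambda>i j. if j = 0 then monom (of_nat i * lam) i else 0)"

definition augmentation_lie ::
  "('k :: field_char_0 poly \<Rightarrow> 'k poly \<Rightarrow> 'k poly) \<Rightarrow> ('k, 'k poly) lie_alg" where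
  "augmentation_lie pl =
     \<lparr>lspace = module.span smult {monom 1 k | k. k \<ge> 1},
      lscale = smult,
      lbracket = (\<lambda>p q. pl p q - pl q p)\<rparr>"

end

theory Submission
  imports Defs
begin

text \<open>
  On \<open>X\<^sup>i\<close> with \<open>i \<ge> 1\<close>, each of the four brackets has the form
  \<open>[X\<^sup>i, X\<^sup>j] = (\<beta> i j - \<beta> j i) X\<^bsup>i+j\<^esup>\<close>. The semidirect sums
  have a basis \<open>c\<^sub>1, c\<^sub>2, \<dots>\<close> of the same shape, \<open>[c\<^sub>i, c\<^sub>j] = \<gamma> i j c\<^bsub>i+j\<^esub>\<close>. So an
  isomorphism that respects the grading is just a choice of nonzero weights \<open>w\<close> with
  \<open>w i w j (\<beta> i j - \<beta> j i) = \<gamma> i j w (i+j)\<close>, sending \<open>w i X\<^sup>i\<close> to \<open>c\<^sub>i\<close>.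

  For the first and the third family, write \<open>i = N k + r\<close> with \<open>0 \<le> r < N\<close>. The basis vector
  \<open>c\<^sub>i\<close> is \<open>e\<^sub>k\<close> if \<open>r = 0\<close> and \<open>f\<^sub>k\<close> in the module of parameter \<open>r/N\<close> otherwise. Then
  \<open>\<gamma> i j = (i [N | j] - j [N | i]) / N\<close>, because \<open>k + r/N = i/N\<close>. Both families have
  \<open>\<beta> i j = [N | j] i / v (j/N)\<close> with \<open>v\<close> an affine function, namely \<open>v k = (k + b)/a\<close> and
  \<open>v k = 1/\<mu>\<close>. An affine function satisfies \<open>k v k - l v l = (k - l) v (k + l)\<close>, and this is what
  makes \<open>w (N k) = v k / N\<close>, with weight \<open>1\<close> elsewhere, a solution
  (\<open>augmentation_isomorphic_fdb_sum\<close>).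

  For the second family only \<open>X\<^sup>N\<close> acts, and the generator of the line is \<open>X\<^sup>N / \<mu>\<close>. The weights
  must then satisfy \<open>w (i + N) = i w i\<close> for \<open>i \<noteq> N\<close>, which a product over each residue class
  solves (\<open>augmentation_isomorphic_shift_sum\<close>). In the fourth family all \<open>\<beta>\<close> vanish.

  That both sides are Lie algebras is checked once, on the structure constants \<open>\<gamma>\<close>
  (\<open>graded_spanning_lie_algebra\<close>).
\<close>

section \<open>Bilinear maps and finite sums over coefficients\<close>

definition bilinear_over where
  "bilinear_over s t u f \<longleftrightarrow> (\<forall>y. module_hom s u (\<lambda>x. f x y)) \<and> (\<forall>x. module_hom t u (f x))"

lemma bilinear_overI:
  assumes "module s" "module t" "module u"
    and "\<And>x x' y. f (x + x') y = f x y + f x' y" "\<And>c x y. f (s c x) y = u c (f x y)"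
    and "\<And>x y y'. f x (y + y') = f x y + f x y'" "\<And>c x y. f x (t c y) = u c (f x y)"
  shows "bilinear_over s t u f"
  using assms by (simp add: bilinear_over_def module_hom_iff)

lemma bilinear_overD:
  assumes "bilinear_over s t u f"
  shows "module s" "module t" "module u"
    and "f (x + x') y = f x y + f x' y" "f (s c x) y = u c (f x y)"
    and "f x (y + y') = f x y + f x y'" "f x (t c y) = u c (f x y)"
  using assms by (auto simp: bilinear_over_def module_hom_iff)

lemma bilinear_over_zero:
  assumes "bilinear_over s t u f"
  shows "f 0 y = 0" "f x 0 = 0"
  using bilinear_overD(4)[OF assms, of 0 0 y] bilinear_overD(6)[OF assms, of x 0 0] by simp_all

lemma bilinear_over_eq_on_span:
  assumes f: "bilinear_over s t u f" and g: "bilinear_over s t u g"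
    and eq: "\<And>x y. \<lbrakk>x \<in> A; y \<in> B\<rbrakk> \<Longrightarrow> f x y = g x y"
    and x: "x \<in> module.span s A" and y: "y \<in> module.span t B"
  shows "f x y = g x y"
proof -
  note mods = bilinear_overD(1-3)[OF f]
  have *: "f x' y = g x' y" if "x' \<in> A" for x'
    by (rule module_pair.module_hom_eq_on_span[OF module_pair.intro[OF mods(2,3)] _ _ _ y])
      (use f g eq that in \<open>auto simp: bilinear_over_def\<close>)
  show ?thesis
    by (rule module_pair.module_hom_eq_on_span[OF module_pair.intro[OF mods(1,3)] _ _ * x])
      (use f g in \<open>auto simp: bilinear_over_def\<close>)
qed

lemma sum_keys_add:
  fixes f :: "'i \<Rightarrow> 'a :: ab_group_add \<Rightarrow> 'b :: ab_group_add"
  assumes "\<And>i a b. f i (a + b) = f i a + f i b"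
  shows "(\<Sum>i\<in>Poly_Mapping.keys (x + y). f i (Poly_Mapping.lookup (x + y) i)) =
    (\<Sum>i\<in>Poly_Mapping.keys x. f i (Poly_Mapping.lookup x i)) +
    (\<Sum>i\<in>Poly_Mapping.keys y. f i (Poly_Mapping.lookup y i))"
proof (rule setsum_keys_plus_distrib)
  show "f k 0 = 0" for k using assms[of k 0 0] by simp
qed (rule assms)

lemma vector_space_smult: "vector_space (smult :: 'k :: field \<Rightarrow> _)"
  by unfold_locales (simp_all add: smult_add_right smult_add_left)

lemma lookup_free_scale [simp]:
  "Poly_Mapping.lookup (free_scale c x) i = c * Poly_Mapping.lookup x i"
  by (simp add: free_scale_def Poly_Mapping.map.rep_eq when_def)

lemma free_scale_single [simp]:
  "free_scale c (Poly_Mapping.single i d) = Poly_Mapping.single i (c * d)"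
  by (rule poly_mapping_eqI) (simp add: lookup_single when_def)

lemma free_scale_zero_left [simp]: "free_scale 0 x = 0"
  by (rule poly_mapping_eqI) simp

lemma free_scale_zero_right [simp]: "free_scale (c :: 'k :: field) 0 = 0"
  by (rule poly_mapping_eqI) simp

lemma vector_space_free_scale: "vector_space (free_scale :: 'k :: field \<Rightarrow> ('i \<Rightarrow>\<^sub>0 'k) \<Rightarrow> _)"
  by unfold_locales (auto intro!: poly_mapping_eqI simp: lookup_add algebra_simps)

lemma free_scale_sum:
  "free_scale c (sum f A) = (\<Sum>i\<in>A. free_scale (c :: 'k :: field) (f i))"
  by (rule module.scale_sum_right) (simp add: module_iff_vector_space vector_space_free_scale)

lemma sum_keys_free_scale:
  fixes f :: "'i \<Rightarrow> 'k :: field \<Rightarrow> 'j \<Rightarrow>\<^sub>0 'k"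
  assumes "\<And>i a. f i (c * a) = free_scale c (f i a)"
  shows "(\<Sum>i\<in>Poly_Mapping.keys (free_scale c x). f i (Poly_Mapping.lookup (free_scale c x) i)) =
    free_scale c (\<Sum>i\<in>Poly_Mapping.keys x. f i (Poly_Mapping.lookup x i))"
proof (cases "c = 0")
  case True
  then show ?thesis using True by simp
next
  case False
  then have "Poly_Mapping.keys (free_scale c x) = Poly_Mapping.keys x"
    by (auto simp: in_keys_iff)
  then show ?thesis by (simp add: assms free_scale_sum)
qed

lemma module_free_scale: "module (free_scale :: 'k :: field \<Rightarrow> ('i \<Rightarrow>\<^sub>0 'k) \<Rightarrow> _)"
  by (simp add: module_iff_vector_space vector_space_free_scale)

lemma free_scale_add_left: "free_scale (a + b) x = free_scale a x + free_scale (b :: 'k :: field) x"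
  by (rule module.scale_left_distrib[OF module_free_scale])

lemma free_scale_scale: "free_scale a (free_scale b x) = free_scale (a * b :: 'k :: field) x"
  by (rule module.scale_scale[OF module_free_scale])

lemma bilinear_free_bilinear:
  "bilinear_over free_scale free_scale free_scale (free_bilinear (B :: 'i \<Rightarrow> 'j \<Rightarrow> ('l \<Rightarrow>\<^sub>0 'k :: field)))"
proof (rule bilinear_overI)
  fix x x' :: "'i \<Rightarrow>\<^sub>0 'k" and y y' :: "'j \<Rightarrow>\<^sub>0 'k" and c :: 'k
  show "free_bilinear B (x + x') y = free_bilinear B x y + free_bilinear B x' y"
    unfolding free_bilinear_def
    by (rule sum_keys_add) (simp add: distrib_right free_scale_add_left sum.distrib)
  show "free_bilinear B (free_scale c x) y = free_scale c (free_bilinear B x y)"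
    unfolding free_bilinear_def
    by (rule sum_keys_free_scale) (simp add: free_scale_sum free_scale_scale mult.assoc)
  show "free_bilinear B x (y + y') = free_bilinear B x y + free_bilinear B x y'"
    unfolding free_bilinear_def sum.distrib[symmetric]
    by (intro sum.cong refl sum_keys_add) (simp add: distrib_left free_scale_add_left)
  show "free_bilinear B x (free_scale c y) = free_scale c (free_bilinear B x y)"
    unfolding free_bilinear_def free_scale_sum[of c _ "Poly_Mapping.keys x"]
    by (intro sum.cong refl sum_keys_free_scale)
      (simp add: free_scale_sum free_scale_scale mult.left_commute)
qed (simp_all add: module_free_scale)

lemma free_bilinear_single:
  "free_bilinear B (Poly_Mapping.single i c) (Poly_Mapping.single j d) = free_scale (c * d) (B i j)"
  by (simp add: free_bilinear_def)

text \<open>A subspace can be shown to contain a vector of a free space by treating the multiples of the basis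
  vectors only. The values lie in an arbitrary group, so that the rule also serves for families of
  vectors.\<close>

lemma poly_mapping_closure [consumes 1, case_names zero add single]:
  fixes x :: "'i \<Rightarrow>\<^sub>0 'a :: ab_group_add"
  assumes "Poly_Mapping.keys x \<subseteq> K" and "P 0" and "\<And>x y. P x \<Longrightarrow> P y \<Longrightarrow> P (x + y)"
    and "\<And>i a. i \<in> K \<Longrightarrow> P (Poly_Mapping.single i a)"
  shows "P x"
proof -
  have "P (\<Sum>i\<in>S. Poly_Mapping.single i (f i))" if "finite S" "S \<subseteq> K" for S f
    using that by (induction S) (auto intro: assms)
  moreover have "x = (\<Sum>i\<in>Poly_Mapping.keys x. Poly_Mapping.single i (Poly_Mapping.lookup x i))"
    by (rule poly_mapping_eqI)
      (simp add: lookup_sum lookup_single when_def in_keys_iff sum.delta)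
  ultimately show ?thesis using assms(1) by (metis finite_keys)
qed

text \<open>A polynomial is summed up to its degree, and the degree of a sum can drop. A summand that vanishes
  on the coefficient 0 allows a common upper bound for all polynomials involved.\<close>

lemma sum_degree_mono:
  fixes f :: "nat \<Rightarrow> 'a :: zero \<Rightarrow> 'b :: comm_monoid_add"
  assumes "\<And>i. f i 0 = 0" "degree p \<le> n"
  shows "(\<Sum>i\<le>degree p. f i (coeff p i)) = (\<Sum>i\<le>n. f i (coeff p i))"
  using assms by (intro sum.mono_neutral_left) (auto simp: coeff_eq_0)

lemma sum_degree_add:
  fixes f :: "nat \<Rightarrow> 'a :: ab_group_add \<Rightarrow> 'b :: ab_group_add"
  assumes add: "\<And>i a b. f i (a + b) = f i a + f i b"
  shows "(\<Sum>i\<le>degree (p + q). f i (coeff (p + q) i)) =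
    (\<Sum>i\<le>degree p. f i (coeff p i)) + (\<Sum>i\<le>degree q. f i (coeff q i))"
proof -
  define n where "n = max (degree p) (degree q)"
  have zero: "f i 0 = 0" for i using add[of i 0 0] by simp
  have eq: "(\<Sum>i\<le>degree r. f i (coeff r i)) = (\<Sum>i\<le>n. f i (coeff r i))" if "degree r \<le> n" for r
    using zero that by (rule sum_degree_mono)
  have le: "degree (p + q) \<le> n" "degree p \<le> n" "degree q \<le> n"
    by (simp_all add: n_def degree_add_le_max)
  show ?thesis
    unfolding eq[OF le(1)] eq[OF le(2)] eq[OF le(3)] by (simp add: add sum.distrib)
qed

lemma sum_degree_scale:
  fixes f :: "nat \<Rightarrow> 'k :: field \<Rightarrow> 'b :: ab_group_add"
  assumes "module s" and scale: "\<And>i a. f i (c * a) = s c (f i a)"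
  shows "(\<Sum>i\<le>degree (smult c p). f i (coeff (smult c p) i)) = s c (\<Sum>i\<le>degree p. f i (coeff p i))"
proof (cases "c = 0")
  case True
  then show ?thesis
    using scale[of 0 0] by (simp add: module.scale_zero_left[OF assms(1)])
next
  case False
  then show ?thesis by (simp add: scale module.scale_sum_right[OF assms(1)])
qed

lemma sum_degree_monom:
  fixes f :: "nat \<Rightarrow> 'a :: zero \<Rightarrow> 'b :: comm_monoid_add"
  assumes "\<And>i. f i 0 = 0"
  shows "(\<Sum>i\<le>degree (monom c n). f i (coeff (monom c n) i)) = f n c"
proof -
  have "(\<Sum>i\<le>degree (monom c n). f i (coeff (monom c n) i)) = (\<Sum>i\<le>n. f i (coeff (monom c n) i))"
    using assms by (rule sum_degree_mono) (rule degree_monom_le)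
  also have "\<dots> = (\<Sum>i\<le>n. if n = i then f n c else 0)"
    using assms by (intro sum.cong) auto
  finally show ?thesis by simp
qed

lemma module_smult: "module (smult :: 'k :: field \<Rightarrow> _)"
  by (simp add: module_iff_vector_space vector_space_smult)

lemma smult_sum_right: "smult (c :: 'k :: field) (sum f A) = (\<Sum>i\<in>A. smult c (f i))"
  by (rule module.scale_sum_right[OF module_smult])

lemma module_mult: "module ((*) :: 'k :: field \<Rightarrow> _)"
  by unfold_locales (simp_all add: algebra_simps)

lemma bilinear_poly_bilinear:
  "bilinear_over smult smult smult (poly_bilinear (B :: nat \<Rightarrow> nat \<Rightarrow> 'k :: field poly))"
proof (rule bilinear_overI)
  fix x x' y y' :: "'k poly" and c :: 'k
  show "poly_bilinear B (x + x') y = poly_bilinear B x y + poly_bilinear B x' y"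
    unfolding poly_bilinear_def
    by (rule sum_degree_add) (simp add: distrib_right smult_add_left sum.distrib)
  show "poly_bilinear B (smult c x) y = smult c (poly_bilinear B x y)"
    unfolding poly_bilinear_def
    by (rule sum_degree_scale[OF module_smult]) (simp add: smult_sum_right mult.assoc)
  show "poly_bilinear B x (y + y') = poly_bilinear B x y + poly_bilinear B x y'"
    unfolding poly_bilinear_def sum.distrib[symmetric]
    by (intro sum.cong refl sum_degree_add) (simp add: distrib_left smult_add_left)
  show "poly_bilinear B x (smult c y) = smult c (poly_bilinear B x y)"
    unfolding poly_bilinear_def smult_sum_right[of c _ "{..degree x}"]
    by (intro sum.cong refl sum_degree_scale[OF module_smult]) (simp add: mult.left_commute)
qed (simp_all add: module_smult)

lemma poly_bilinear_monom:
  "poly_bilinear B (monom c i) (monom d j) = smult (c * d) (B i j)"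
proof -
  have "(\<Sum>l\<le>degree (monom d j). smult (a * coeff (monom d j) l) (B k l)) = smult (a * d) (B k j)"
    for a k by (rule sum_degree_monom) simp
  then show ?thesis
    unfolding poly_bilinear_def by (simp only:) (rule sum_degree_monom, simp)
qed

section \<open>Lie algebras with a graded basis\<close>

definition bilinear_bracket :: "('k :: field, 'v :: ab_group_add) lie_alg \<Rightarrow> bool" where
  "bilinear_bracket L \<longleftrightarrow> bilinear_over (lscale L) (lscale L) (lscale L) (lbracket L)"

text \<open>Bilinear identities for the bracket can be checked on a spanning family. Independence enters
  separately, through dual functionals, when an isomorphism is built.\<close>

definition graded_spanning ::
  "(nat \<Rightarrow> nat \<Rightarrow> 'k) \<Rightarrow> (nat \<Rightarrow> 'v) \<Rightarrow> ('k :: field, 'v :: ab_group_add) lie_alg \<Rightarrow> bool"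
where
  "graded_spanning \<gamma> c L \<longleftrightarrow>
     bilinear_bracket L \<and> lspace L = module.span (lscale L) (c ` {1..}) \<and>
     (\<forall>i\<ge>1. \<forall>j\<ge>1. lbracket L (c i) (c j) = lscale L (\<gamma> i j) (c (i + j)))"

text \<open>The Jacobi expression is linear in each argument and invariant under cyclic permutations, so it
  vanishes on the span if it does on the vectors \<open>c i\<close>, where it is a quadratic identity for the
  structure constants. The characteristic enters when \<open>[x, x] = 0\<close> is deduced from antisymmetry.\<close>

lemma graded_spanning_lie_algebra:
  fixes L :: "('k :: field_char_0, 'v :: ab_group_add) lie_alg"
  assumes L: "graded_spanning \<gamma> c L"
    and anti: "\<And>i j. \<lbrakk>i \<ge> 1; j \<ge> 1\<rbrakk> \<Longrightarrow> \<gamma> i j = - \<gamma> j i"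
    and jac: "\<And>i j k. \<lbrakk>i \<ge> 1; j \<ge> 1; k \<ge> 1\<rbrakk> \<Longrightarrow>
      \<gamma> j k * \<gamma> i (j + k) + \<gamma> k i * \<gamma> j (k + i) + \<gamma> i j * \<gamma> k (i + j) = 0"
  shows "lie_algebra L"
proof -
  define s where "s = lscale L"
  define br where "br = lbracket L"
  have bil: "bilinear_over s s s br"
    using L by (simp add: graded_spanning_def bilinear_bracket_def s_def br_def)
  have space: "lspace L = module.span s (c ` {1..})"
    using L by (simp add: graded_spanning_def s_def)
  have br: "br (c i) (c j) = s (\<gamma> i j) (c (i + j))" if "i \<ge> 1" "j \<ge> 1" for i j
    using L that by (auto simp: graded_spanning_def s_def br_def)
  note bilD = bilinear_overD(4-)[OF bil]
  interpret module s using bil by (rule bilinear_overD)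
  interpret module_pair s s ..
  have closed: "br x y \<in> span (c ` {1..})" if "x \<in> span (c ` {1..})" "y \<in> span (c ` {1..})" for x y
  proof -
    have "br x' y \<in> span (c ` {1..})" if "x' \<in> c ` {1..}" for x'
      using \<open>y \<in> span _\<close>
    proof (induction rule: span_induct)
      case base
      show ?case
        by (auto simp: subspace_def bilD bilinear_over_zero[OF bil] span_add span_scale span_zero)
    next
      case (step y')
      then obtain j where "j \<ge> 1" "y' = c j" by auto
      moreover obtain i where "i \<ge> 1" "x' = c i" using \<open>x' \<in> _\<close> by auto
      ultimately show ?case by (simp add: br) (intro span_scale span_base imageI, simp)
    qed
    from that(1) this show ?thesis
    proof (induction rule: span_induct)
      case base
      show ?case
        by (auto simp: subspace_def bilD bilinear_over_zero[OF bil] span_add span_scale span_zero)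
    qed auto
  qed
  have skew: "br x y = - br y x" if "x \<in> span (c ` {1..})" "y \<in> span (c ` {1..})" for x y
  proof (rule bilinear_over_eq_on_span[OF bil _ _ that])
    show "bilinear_over s s s (\<lambda>x y. - br y x)"
      by (rule bilinear_overI) (simp_all add: module_axioms bilD)
    show "br x y = - br y x" if "x \<in> c ` {1..}" "y \<in> c ` {1..}" for x y
    proof -
      obtain i j where "i \<ge> 1" "j \<ge> 1" "x = c i" "y = c j" using \<open>x \<in> _\<close> \<open>y \<in> _\<close> by auto
      then show ?thesis using anti[of i j] br by (simp add: add.commute)
    qed
  qed
  define J where "J x y z = br x (br y z) + br y (br z x) + br z (br x y)" for x y z
  have hom: "module_hom s s (\<lambda>x. J x y z)" for y z
    by (simp add: module_hom_iff J_def bilD module_axioms algebra_simps)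
  have cyc: "J x y z = J y z x" for x y z
    by (simp add: J_def algebra_simps)
  \<comment> \<open>The arguments are extended from the generators to the span one at a time, each being rotated
    into the first place.\<close>
  have ker: "J x y z = 0" if "\<And>x. x \<in> c ` {1..} \<Longrightarrow> J x y z = 0" "x \<in> span (c ` {1..})" for x y z
    using module_hom.eq_0_on_span[OF hom] that by blast
  have J0: "J x y z = 0" if basis: "x \<in> c ` {1..}" "y \<in> c ` {1..}" "z \<in> c ` {1..}" for x y z
  proof -
    obtain i j k where ijk: "i \<ge> 1" "j \<ge> 1" "k \<ge> 1" and xyz: "x = c i" "y = c j" "z = c k"
      using basis by auto
    have "J x y z = s (\<gamma> j k * \<gamma> i (j + k) + \<gamma> k i * \<gamma> j (k + i) + \<gamma> i j * \<gamma> k (i + j)) (c (i + j + k))"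
      using ijk by (simp add: J_def xyz br bilD scale_left_distrib ac_simps)
    then show ?thesis using jac[OF ijk] by simp
  qed
  have J1: "J x y z = 0" if "x \<in> span (c ` {1..})" "y \<in> c ` {1..}" "z \<in> c ` {1..}" for x y z
    using ker[OF J0] that by blast
  have J2: "J x y z = 0" if "x \<in> span (c ` {1..})" "y \<in> span (c ` {1..})" "z \<in> c ` {1..}" for x y z
    using ker[of z x y] J1 cyc that by metis
  have J3: "J x y z = 0" if "x \<in> span (c ` {1..})" "y \<in> span (c ` {1..})" "z \<in> span (c ` {1..})" for x y z
    using ker[of x y z] J2 cyc that by metis
  have self: "br x x = 0" if "x \<in> span (c ` {1..})" for x
  proof -
    have "s 2 (br x x) = br x x + br x x"
      using scale_left_distrib[of 1 1 "br x x"] by simp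
    also have "\<dots> = 0" using skew[OF that that] by (metis add.left_inverse)
    finally have "s (1/2) (s 2 (br x x)) = 0" by simp
    then show ?thesis by simp
  qed
  show ?thesis
  proof (rule lie_algebra.intro)
    show "vector_space (lscale L)"
      using module_axioms by (simp add: s_def module_iff_vector_space)
  qed (use closed self J3 in \<open>auto simp: space bilD simp flip: s_def br_def J_def\<close>)
qed

section \<open>The augmentation ideal\<close>

lemma bilinear_bracket_augmentation:
  fixes B :: "nat \<Rightarrow> nat \<Rightarrow> 'k :: field_char_0 poly"
  shows "bilinear_bracket (augmentation_lie (poly_bilinear B))"
  unfolding bilinear_bracket_def
  by (rule bilinear_overI)
    (simp_all add: augmentation_lie_def module_smult bilinear_overD[OF bilinear_poly_bilinear]
      smult_diff_right)

lemma graded_spanning_augmentation: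
  fixes B :: "nat \<Rightarrow> nat \<Rightarrow> 'k :: field_char_0 poly"
  assumes B: "\<And>i j. \<lbrakk>i \<ge> 1; j \<ge> 1\<rbrakk> \<Longrightarrow> B i j = monom (\<beta> i j) (i + j)"
    and w: "\<And>i. i \<ge> 1 \<Longrightarrow> w i \<noteq> 0"
    and rel: "\<And>i j. \<lbrakk>i \<ge> 1; j \<ge> 1\<rbrakk> \<Longrightarrow> w i * w j * (\<beta> i j - \<beta> j i) = \<gamma> i j * w (i + j)"
  shows "graded_spanning \<gamma> (\<lambda>i. monom (w i) i) (augmentation_lie (poly_bilinear B))"
proof -
  interpret module "smult :: 'k \<Rightarrow> _" by (rule module_smult)
  have "span {monom 1 k |k. k \<ge> 1} = span ((\<lambda>i. monom (w i) i) ` {1..})"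
    unfolding span_eq
  proof safe
    fix k :: nat assume k: "k \<ge> 1"
    have "monom 1 k = smult (1 / w k) (monom (w k) k)" using w[OF k] by (simp add: smult_monom)
    then show "monom 1 k \<in> span ((\<lambda>i. monom (w i) i) ` {1..})"
      using k by (simp only:) (intro span_scale span_base, auto)
    have "monom (w k) k = smult (w k) (monom 1 k)" by (simp add: smult_monom)
    then show "monom (w k) k \<in> span {monom 1 k |k. k \<ge> 1}"
      using k by (simp only:) (intro span_scale span_base, auto)
  qed
  moreover have "lbracket (augmentation_lie (poly_bilinear B)) (monom (w i) i) (monom (w j) j) =
      smult (\<gamma> i j) (monom (w (i + j)) (i + j))" if "i \<ge> 1" "j \<ge> 1" for i j
    using that rel[OF that]
    by (simp add: augmentation_lie_def poly_bilinear_monom B smult_monom diff_monom add.commute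
        right_diff_distrib mult.commute)
  ultimately show ?thesis
    using bilinear_bracket_augmentation[of B]
    by (auto simp: graded_spanning_def augmentation_lie_def)
qed

text \<open>The map is determined by \<open>w i X\<^sup>i \<mapsto> c i\<close>, and it preserves brackets since the structure
  constants agree. It is onto as the images span. It is injective because the functionals \<open>\<kappa> i\<close>,
  dual to the vectors \<open>c j\<close>, recover the coefficients: \<open>coeff p i = w i * \<kappa> i (\<phi> p)\<close>.\<close>

lemma augmentation_isomorphic:
  fixes B :: "nat \<Rightarrow> nat \<Rightarrow> 'k :: field_char_0 poly"
    and M :: "('k, 'v :: ab_group_add) lie_alg"
  assumes L: "graded_spanning \<gamma> (\<lambda>i. monom (w i) i) (augmentation_lie (poly_bilinear B))"
    and M: "graded_spanning \<gamma> c M"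
    and w: "\<And>i. i \<ge> 1 \<Longrightarrow> w i \<noteq> 0"
    and \<kappa>: "\<And>i. i \<ge> 1 \<Longrightarrow> module_hom (lscale M) (*) (\<kappa> i)"
      "\<And>i j. \<lbrakk>i \<ge> 1; j \<ge> 1\<rbrakk> \<Longrightarrow> \<kappa> i (c j) = of_bool (i = j)"
    and anti: "\<And>i j. \<lbrakk>i \<ge> 1; j \<ge> 1\<rbrakk> \<Longrightarrow> \<gamma> i j = - \<gamma> j i"
    and jac: "\<And>i j k. \<lbrakk>i \<ge> 1; j \<ge> 1; k \<ge> 1\<rbrakk> \<Longrightarrow>
      \<gamma> j k * \<gamma> i (j + k) + \<gamma> k i * \<gamma> j (k + i) + \<gamma> i j * \<gamma> k (i + j) = 0"
  shows "augmentation_lie (poly_bilinear B) \<simeq>\<^sub>L M"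
proof -
  define L where "L = augmentation_lie (poly_bilinear B)"
  define b where "b i = monom (w i) i" for i
  define s where "s = lscale M"
  note L = L[folded b_def L_def]
  have Lscale: "lscale L = smult" by (simp add: L_def augmentation_lie_def)
  have bilL: "bilinear_over smult smult smult (lbracket L)"
    and spaceL: "lspace L = module.span smult (b ` {1..})"
    and brL: "\<And>i j. i \<ge> 1 \<Longrightarrow> j \<ge> 1 \<Longrightarrow> lbracket L (b i) (b j) = smult (\<gamma> i j) (b (i + j))"
    using L by (auto simp: graded_spanning_def bilinear_bracket_def Lscale)
  have bilM: "bilinear_over s s s (lbracket M)"
    and spaceM: "lspace M = module.span s (c ` {1..})"
    and brM: "\<And>i j. i \<ge> 1 \<Longrightarrow> j \<ge> 1 \<Longrightarrow> lbracket M (c i) (c j) = s (\<gamma> i j) (c (i + j))"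
    using M by (auto simp: graded_spanning_def bilinear_bracket_def s_def)
  interpret m: module s using bilM by (rule bilinear_overD)
  interpret p: module "smult :: 'k \<Rightarrow> _" by (rule module_smult)
  interpret pk: module_pair "smult :: 'k \<Rightarrow> _" "(*) :: 'k \<Rightarrow> 'k \<Rightarrow> 'k"
    by unfold_locales (simp_all add: algebra_simps smult_add_left smult_add_right)
  define \<phi> where "\<phi> p = (\<Sum>i\<le>degree p. s (coeff p i / w i) (c i))" for p
  have hom: "module_hom smult s \<phi>"
    unfolding module_hom_iff \<phi>_def
  proof (intro conjI allI)
    show "(\<Sum>i\<le>degree (p + q). s (coeff (p + q) i / w i) (c i)) =
        (\<Sum>i\<le>degree p. s (coeff p i / w i) (c i)) + (\<Sum>i\<le>degree q. s (coeff q i / w i) (c i))" for p q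
      by (rule sum_degree_add) (simp add: add_divide_distrib m.scale_left_distrib)
    show "(\<Sum>i\<le>degree (smult d p). s (coeff (smult d p) i / w i) (c i)) =
        s d (\<Sum>i\<le>degree p. s (coeff p i / w i) (c i))" for d p
      by (rule sum_degree_scale[OF m.module_axioms]) simp
  qed (rule module_smult, rule m.module_axioms)
  interpret \<phi>: module_hom smult s \<phi> by (rule hom)
  have \<phi>_b: "\<phi> (b i) = c i" if "i \<ge> 1" for i
  proof -
    have "\<phi> (b i) = s (w i / w i) (c i)"
      unfolding \<phi>_def b_def by (rule sum_degree_monom) simp
    then show ?thesis using w[OF that] by simp
  qed
  have coeff_hom: "module_hom smult (*) (\<lambda>p. coeff p i)" for i
    by unfold_locales (simp_all add: algebra_simps smult_add_left smult_add_right)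
  have coeff_0: "coeff p 0 = 0" if "p \<in> p.span (b ` {1..})" for p
    by (rule module_hom.eq_0_on_span[OF coeff_hom _ that]) (auto simp: b_def)
  have \<kappa>_\<phi>: "coeff p i = w i * \<kappa> i (\<phi> p)" if "p \<in> p.span (b ` {1..})" "i \<ge> 1" for p i
  proof (rule pk.module_hom_eq_on_span[OF coeff_hom _ _ that(1)])
    interpret \<kappa>: module_hom s "(*)" "\<kappa> i" using \<kappa>(1)[OF that(2)] by (simp add: s_def)
    show "module_hom smult (*) (\<lambda>p. w i * \<kappa> i (\<phi> p))"
      using module_smult module_mult[where 'k = 'k]
      by (simp add: module_hom_iff \<phi>.add \<phi>.scale \<kappa>.add \<kappa>.scale distrib_left mult.left_commute)
    show "coeff q i = w i * \<kappa> i (\<phi> q)" if "q \<in> b ` {1..}" for q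
    proof -
      obtain j where j: "j \<ge> 1" "q = b j" using \<open>q \<in> _\<close> by auto
      then have "\<kappa> i (\<phi> q) = of_bool (i = j)" using \<kappa>(2)[OF \<open>i \<ge> 1\<close>] by (simp add: \<phi>_b)
      then show ?thesis using j by (simp add: b_def)
    qed
  qed
  have "bij_betw \<phi> (lspace L) (lspace M)"
    unfolding bij_betw_def
  proof
    show "inj_on \<phi> (lspace L)"
    proof (rule inj_onI, rule poly_eqI)
      fix p q i assume "p \<in> lspace L" "q \<in> lspace L" "\<phi> p = \<phi> q"
      then show "coeff p i = coeff q i"
        using coeff_0 \<kappa>_\<phi> by (cases "i = 0") (auto simp: spaceL)
    qed
    have "\<phi> ` b ` {1..} = c ` {1..}" by (simp add: image_image \<phi>_b)
    then show "\<phi> ` lspace L = lspace M" by (metis spaceL spaceM \<phi>.span_image)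
  qed
  moreover have "\<phi> (lbracket L x y) = lbracket M (\<phi> x) (\<phi> y)" if "x \<in> lspace L" "y \<in> lspace L" for x y
  proof (rule bilinear_over_eq_on_span[OF _ _ _ that[unfolded spaceL]])
    show "bilinear_over smult smult s (\<lambda>x y. \<phi> (lbracket L x y))"
      by (rule bilinear_overI)
        (simp_all add: module_smult m.module_axioms bilinear_overD[OF bilL] \<phi>.add \<phi>.scale)
    show "bilinear_over smult smult s (\<lambda>x y. lbracket M (\<phi> x) (\<phi> y))"
      by (rule bilinear_overI)
        (simp_all add: module_smult m.module_axioms bilinear_overD(4-)[OF bilM] \<phi>.add \<phi>.scale)
    show "\<phi> (lbracket L x y) = lbracket M (\<phi> x) (\<phi> y)" if "x \<in> b ` {1..}" "y \<in> b ` {1..}" for x y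
      using that by (auto simp: brL brM \<phi>_b \<phi>.scale)
  qed
  ultimately have "lie_iso \<phi> L M"
    by (auto simp: lie_iso_def \<phi>.add \<phi>.scale Lscale simp flip: s_def)
  moreover have "lie_algebra L" "lie_algebra M"
    using graded_spanning_lie_algebra[OF L anti jac] graded_spanning_lie_algebra[OF M anti jac] by auto
  ultimately show ?thesis by (auto simp: lie_isomorphic_def L_def)
qed

section \<open>Semidirect sums\<close>

text \<open>Bilinearity is stated on the whole underlying types and not just on the spaces of the structures:
  this keeps membership conditions out of the later computations.\<close>

lemma bilinear_bracket_semidirect:
  fixes M :: "('k :: field, 'm :: ab_group_add, 'h :: ab_group_add) right_mod"
  assumes M: "bilinear_over (mscale M) (lscale H) (mscale M) (mact M)" and H: "bilinear_bracket H"
  shows "bilinear_bracket (M \<oplus>\<^sub>\<tau> H)"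
proof -
  interpret m: module "mscale M" using M by (rule bilinear_overD)
  interpret h: module "lscale H" using M by (rule bilinear_overD)
  have "module (lscale (M \<oplus>\<^sub>\<tau> H))"
    by unfold_locales
      (auto simp: semidirect_def plus_prod_def m.scale_right_distrib m.scale_left_distrib
        h.scale_right_distrib h.scale_left_distrib)
  then show ?thesis
    unfolding bilinear_bracket_def
    by (intro bilinear_overI)
      (auto simp: semidirect_def bilinear_overD(4-)[OF M] m.scale_right_diff_distrib
        bilinear_overD(4-)[OF H[unfolded bilinear_bracket_def]])
qed

text \<open>The maps \<open>f i\<close> are applied at the keys of \<open>x\<close> only, so a formula that holds at every index
  requires them to preserve 0.\<close>

lemma lookup_mapp_zero:
  assumes "\<And>i. f i 0 = 0"
  shows "Poly_Mapping.lookup (Poly_Mapping.mapp f x) i = f i (Poly_Mapping.lookup x i)"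
  using assms by (simp add: lookup_mapp when_def in_keys_iff)

lemma mapp_single:
  assumes "\<And>i. f i 0 = 0"
  shows "Poly_Mapping.mapp f (Poly_Mapping.single i a) = Poly_Mapping.single i (f i a)"
  using assms by (intro poly_mapping_eqI) (simp add: lookup_mapp_zero lookup_single when_def)

lemma bilinear_module_sum:
  fixes M :: "'i \<Rightarrow> ('k :: field, 'm :: ab_group_add, 'h :: ab_group_add) right_mod"
  assumes M: "\<And>i. bilinear_over (mscale (M i)) t (mscale (M i)) (mact (M i))"
  shows "bilinear_over (mscale (module_sum I M)) t (mscale (module_sum I M)) (mact (module_sum I M))"
proof -
  interpret m: module "mscale (M i)" for i using M by (rule bilinear_overD)
  note lookup [simp] = lookup_mapp_zero[of "\<lambda>i. mscale (M i) c" for c, OF m.scale_zero_right]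
    lookup_mapp_zero[of "\<lambda>i m. mact (M i) m y" for y, OF bilinear_over_zero(1)[OF M]]
  have "module (mscale (module_sum I M))"
    by unfold_locales
      (auto intro!: poly_mapping_eqI simp: module_sum_def lookup_add m.scale_right_distrib m.scale_left_distrib)
  then show ?thesis
    using bilinear_overD(2)[OF M]
    by (intro bilinear_overI)
      (auto intro!: poly_mapping_eqI simp: module_sum_def lookup_add,
        simp_all add: bilinear_overD(4-)[OF M])
qed

section \<open>The semidirect sum of the Faa di Bruno Lie algebra\<close>

text \<open>The structure constants of the sum of the modules of parameters \<open>1/N, \<dots>, (N-1)/N\<close> with the
  Faa di Bruno Lie algebra, when \<open>e\<^sub>k\<close> has index \<open>N k\<close> and the vector \<open>f\<^sub>k\<close> of the module
  of parameter \<open>r/N\<close> has index \<open>N k + r\<close>.\<close>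

definition fdb_coeff :: "nat \<Rightarrow> nat \<Rightarrow> nat \<Rightarrow> 'k :: field_char_0" where
  "fdb_coeff N i j = (of_nat i * of_bool (N dvd j) - of_nat j * of_bool (N dvd i)) / of_nat N"

lemma fdb_coeff_skew: "fdb_coeff N i j = - fdb_coeff N j i"
  by (simp add: fdb_coeff_def minus_divide_left)

text \<open>In \<open>\<gamma> j k \<gamma> i (j+k)\<close> one has to know whether \<open>N\<close> divides \<open>j + k\<close>. If \<open>N\<close> divides \<open>j\<close> or \<open>k\<close>,
  the other index decides; otherwise \<open>\<gamma> j k\<close> is zero.\<close>

lemma fdb_coeff_jacobi:
  "fdb_coeff N j k * fdb_coeff N i (j + k) + fdb_coeff N k i * fdb_coeff N j (k + i) +
    fdb_coeff N i j * fdb_coeff N k (i + j) = 0"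
proof (cases "N = 0")
  case False
  have iff: "N dvd x + y \<longleftrightarrow> N dvd y" "N dvd y + x \<longleftrightarrow> N dvd y" if "N dvd x" for x y
    using that by (auto simp: dvd_add_right_iff dvd_add_left_iff)
  show ?thesis
    by (cases "N dvd i"; cases "N dvd j"; cases "N dvd k")
      (use False in \<open>simp_all add: fdb_coeff_def iff field_simps\<close>)
qed (simp add: fdb_coeff_def)

definition fdb_basis ::
  "nat \<Rightarrow> nat \<Rightarrow> (nat \<Rightarrow>\<^sub>0 (nat \<Rightarrow>\<^sub>0 'k :: field_char_0)) \<times> (nat \<Rightarrow>\<^sub>0 'k)"
where
  "fdb_basis N i =
     (if N dvd i then (0, Poly_Mapping.single (i div N) 1)
      else (Poly_Mapping.single (i mod N) (Poly_Mapping.single (i div N) 1), 0))"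

definition fdb_coord ::
  "nat \<Rightarrow> nat \<Rightarrow> (nat \<Rightarrow>\<^sub>0 (nat \<Rightarrow>\<^sub>0 'k)) \<times> (nat \<Rightarrow>\<^sub>0 'k :: field_char_0) \<Rightarrow> 'k"
where
  "fdb_coord N i = (\<lambda>(F, y).
     if N dvd i then Poly_Mapping.lookup y (i div N)
     else Poly_Mapping.lookup (Poly_Mapping.lookup F (i mod N)) (i div N))"

definition fdb_sum ::
  "nat \<Rightarrow> ('k :: field_char_0, nat \<Rightarrow>\<^sub>0 (nat \<Rightarrow>\<^sub>0 'k), nat \<Rightarrow>\<^sub>0 'k) right_mod"
where
  "fdb_sum N = module_sum {1..<N} (\<lambda>r. FdB_module (of_nat r / of_nat N))"

lemma lookup_mapp_free_scale [simp]:
  "Poly_Mapping.lookup (Poly_Mapping.mapp (\<lambda>_. free_scale (c :: 'k :: field)) F) i =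
    free_scale c (Poly_Mapping.lookup F i)"
  by (rule lookup_mapp_zero) (rule poly_mapping_eqI, simp)

lemma mapp_free_scale_single [simp]:
  "Poly_Mapping.mapp (\<lambda>_. free_scale (c :: 'k :: field)) (Poly_Mapping.single i x) =
    Poly_Mapping.single i (free_scale c x)"
  by (rule mapp_single) (rule poly_mapping_eqI, simp)

lemma mapp_free_scale_zero [simp]:
  "Poly_Mapping.mapp (\<lambda>_. free_scale (c :: 'k :: field)) 0 = 0"
  by (rule poly_mapping_eqI, rule poly_mapping_eqI) simp

lemma bilinear_bracket_fdb_sum: "bilinear_bracket (fdb_sum N \<oplus>\<^sub>\<tau> (FdB :: ('k :: field_char_0, _) lie_alg))"
  unfolding fdb_sum_def
  by (intro bilinear_bracket_semidirect bilinear_module_sum)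
    (simp_all add: FdB_module_def FdB_def bilinear_bracket_def bilinear_free_bilinear)

lemma fdb_sum_space:
  "lspace (fdb_sum N \<oplus>\<^sub>\<tau> FdB) = {F. Poly_Mapping.keys F \<subseteq> {1..<N}} \<times> {y. Poly_Mapping.keys y \<subseteq> {1..}}"
  by (simp add: fdb_sum_def semidirect_def module_sum_def FdB_def FdB_module_def)

lemma fdb_sum_scale:
  "lscale (fdb_sum N \<oplus>\<^sub>\<tau> FdB) = (\<lambda>c (F, y). (Poly_Mapping.mapp (\<lambda>_. free_scale c) F, free_scale c y))"
  by (simp add: fdb_sum_def semidirect_def module_sum_def FdB_def FdB_module_def)

lemma fdb_sum_bracket:
  "lbracket (fdb_sum N \<oplus>\<^sub>\<tau> FdB) (F, x) (G, y) =
    (Poly_Mapping.mapp (\<lambda>r f. mact (FdB_module (of_nat r / of_nat N)) f y) F -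
     Poly_Mapping.mapp (\<lambda>r f. mact (FdB_module (of_nat r / of_nat N)) f x) G,
     lbracket FdB x y)"
  by (simp add: fdb_sum_def semidirect_def module_sum_def)

lemma fdb_sum_spanned:
  assumes "N \<ge> 1"
  shows "lspace (fdb_sum N \<oplus>\<^sub>\<tau> (FdB :: ('k :: field_char_0, _) lie_alg)) =
    module.span (lscale (fdb_sum N \<oplus>\<^sub>\<tau> FdB)) (fdb_basis N ` {1..})" (is "?V = _")
proof -
  let ?s = "lscale (fdb_sum N \<oplus>\<^sub>\<tau> (FdB :: ('k, _) lie_alg))"
  interpret module ?s
    using bilinear_bracket_fdb_sum[of N] unfolding bilinear_bracket_def by (rule bilinear_overD)
  have mem: "(F, y) \<in> ?V \<longleftrightarrow>
      (\<forall>r. r \<notin> {1..<N} \<longrightarrow> Poly_Mapping.lookup F r = 0) \<and> Poly_Mapping.lookup y 0 = 0" for F y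
  proof -
    have "Poly_Mapping.keys F \<subseteq> {1..<N} \<longleftrightarrow> (\<forall>r. r \<notin> {1..<N} \<longrightarrow> Poly_Mapping.lookup F r = 0)"
      by (metis in_keys_iff subset_iff)
    moreover have "Poly_Mapping.keys y \<subseteq> {1..} \<longleftrightarrow> Poly_Mapping.lookup y 0 = 0"
      by (auto simp: in_keys_iff subset_iff Suc_le_eq intro!: gr0I)
    ultimately show ?thesis unfolding fdb_sum_space by simp
  qed
  show ?thesis
  proof
    have "subspace ?V"
      unfolding subspace_def by (auto simp: mem lookup_add fdb_sum_scale zero_prod_def)
    moreover have "fdb_basis N ` {1..} \<subseteq> ?V"
      using assms by (auto simp: fdb_basis_def mem lookup_single when_def elim!: dvdE)
        (auto simp: dvd_eq_mod_eq_0)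
    ultimately show "span (fdb_basis N ` {1..}) \<subseteq> ?V" by (intro span_minimal)
    have "(F, y) \<in> span (fdb_basis N ` {1..})"
      if F: "Poly_Mapping.keys F \<subseteq> {1..<N}" and y: "Poly_Mapping.keys y \<subseteq> {1..}" for F and y :: "nat \<Rightarrow>\<^sub>0 'k"
    proof -
      have basis: "(Poly_Mapping.single r (Poly_Mapping.single k a), 0) \<in> span (fdb_basis N ` {1..})"
        if "r \<in> {1..<N}" for r k and a :: 'k
      proof -
        have "(Poly_Mapping.single r (Poly_Mapping.single k a), 0) = ?s a (fdb_basis N (N * k + r))"
          using that by (auto simp: fdb_basis_def fdb_sum_scale dvd_eq_mod_eq_0 intro!: poly_mapping_eqI)
        then show ?thesis
          using that by (simp only:) (intro span_scale span_base imageI, simp)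
      qed
      have "(Poly_Mapping.single r G, 0) \<in> span (fdb_basis N ` {1..})" if "r \<in> {1..<N}" for r G
        using subset_UNIV[of "Poly_Mapping.keys G"]
      proof (induction G rule: poly_mapping_closure)
        case zero
        show ?case using span_zero by (simp add: zero_prod_def)
      next
        case (add G G')
        from span_add[OF this] show ?case by (simp add: single_add)
      qed (rule basis[OF that])
      with F have 1: "(F, 0) \<in> span (fdb_basis N ` {1..})"
      proof (induction F rule: poly_mapping_closure)
        case zero
        show ?case using span_zero by (simp add: zero_prod_def)
      next
        case (add F F')
        from span_add[OF add(1,2)] add(3) show ?case by simp
      qed
      have 2: "(0, y) \<in> span (fdb_basis N ` {1..})"
        using y
      proof (induction y rule: poly_mapping_closure)
        case zero
        show ?case using span_zero by (simp add: zero_prod_def)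
      next
        case (add y y')
        from span_add[OF this] show ?case by simp
      next
        case (single k a)
        have "(0, Poly_Mapping.single k a) = ?s a (fdb_basis N (N * k))"
          using assms by (auto simp: fdb_basis_def fdb_sum_scale intro!: poly_mapping_eqI)
        then show ?case
          using single assms by (simp only:) (intro span_scale span_base imageI, simp)
      qed
      show ?thesis using span_add[OF 1 2] by simp
    qed
    then show "?V \<subseteq> span (fdb_basis N ` {1..})" by (auto simp: fdb_sum_space)
  qed
qed

lemma graded_spanning_fdb_sum:
  assumes "N \<ge> 1"
  shows "graded_spanning (fdb_coeff N) (fdb_basis N) (fdb_sum N \<oplus>\<^sub>\<tau> (FdB :: ('k :: field_char_0, _) lie_alg))"
proof -
  let ?L = "fdb_sum N \<oplus>\<^sub>\<tau> (FdB :: ('k, _) lie_alg)"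
  let ?e = "\<lambda>k. Poly_Mapping.single k (1 :: 'k)"
  have zero: "mact (FdB_module c) 0 y = 0" "mact (FdB_module c) x 0 = 0" for c :: 'k and x y
    by (simp_all add: FdB_module_def bilinear_over_zero[OF bilinear_free_bilinear])
  have act: "Poly_Mapping.mapp (\<lambda>r f. mact (FdB_module (of_nat r / of_nat N)) f (?e l))
      (Poly_Mapping.single r (?e k)) =
      Poly_Mapping.single r (Poly_Mapping.single (k + l) (of_nat k + of_nat r / of_nat N))" for r k l
    by (simp add: mapp_single zero) (simp add: FdB_module_def free_bilinear_single)
  have act_0: "Poly_Mapping.mapp (\<lambda>r f. mact (FdB_module (of_nat r / of_nat N)) f y) 0 = 0"
    "Poly_Mapping.mapp (\<lambda>r f. mact (FdB_module (of_nat r / of_nat N)) f 0) F = 0" 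
    for y :: "nat \<Rightarrow>\<^sub>0 'k" and F :: "nat \<Rightarrow>\<^sub>0 (nat \<Rightarrow>\<^sub>0 'k)"
    by (auto intro!: poly_mapping_eqI simp: lookup_mapp_zero zero)
  have fdb: "lbracket FdB (?e k) (?e l) = Poly_Mapping.single (k + l) (of_nat k - of_nat l)"
    "lbracket FdB 0 (?e l) = 0" "lbracket FdB (?e l) 0 = 0" "lbracket FdB 0 (0 :: nat \<Rightarrow>\<^sub>0 'k) = 0" for k l
    by (simp_all add: FdB_def free_bilinear_single bilinear_over_zero[OF bilinear_free_bilinear])
  have N: "(of_nat N :: 'k) \<noteq> 0" using assms by simp
  have split: "(of_nat i :: 'k) / of_nat N = of_nat (i div N) + of_nat (i mod N) / of_nat N" for i
  proof -
    have "(of_nat i :: 'k) = of_nat N * of_nat (i div N) + of_nat (i mod N)"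
      by (metis mult_div_mod_eq of_nat_add of_nat_mult)
    then show ?thesis using N by (simp add: add_divide_distrib)
  qed
  have "lbracket ?L (fdb_basis N i) (fdb_basis N j) = lscale ?L (fdb_coeff N i j) (fdb_basis N (i + j))" for i j
  proof (cases "N dvd i"; cases "N dvd j")
    assume *: "N dvd i" "N dvd j"
    then obtain k l where "i = N * k" "j = N * l" by (auto elim!: dvdE)
    then show ?thesis
      using * assms N
      by (auto simp: fdb_basis_def fdb_sum_bracket fdb_sum_scale act_0 fdb fdb_coeff_def
          simp flip: distrib_left right_diff_distrib)
  next
    assume *: "N dvd i" "\<not> N dvd j"
    then obtain k where k: "i = N * k" by (auto elim!: dvdE)
    have "(i + j) div N = j div N + k" "(i + j) mod N = j mod N" "\<not> N dvd i + j"
      using * assms by (simp_all add: k dvd_add_right_iff dvd_add_left_iff)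
    then show ?thesis
      using * assms N
      by (auto simp: fdb_basis_def fdb_sum_bracket fdb_sum_scale act_0 act fdb fdb_coeff_def split[of j] add.commute
          simp flip: minus_divide_left single_uminus)
  next
    assume *: "\<not> N dvd i" "N dvd j"
    then obtain k where k: "j = N * k" by (auto elim!: dvdE)
    have "(i + j) div N = i div N + k" "(i + j) mod N = i mod N" "\<not> N dvd i + j"
      using * assms by (simp_all add: k dvd_add_right_iff dvd_add_left_iff)
    then show ?thesis
      using * assms N
      by (auto simp: fdb_basis_def fdb_sum_bracket fdb_sum_scale act_0 act fdb fdb_coeff_def split[of i])
  next
    assume *: "\<not> N dvd i" "\<not> N dvd j"
    then show ?thesis
      by (auto simp: fdb_basis_def fdb_sum_bracket fdb_sum_scale act_0 fdb fdb_coeff_def intro!: poly_mapping_eqI)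
  qed
  then show ?thesis
    by (simp only: graded_spanning_def bilinear_bracket_fdb_sum fdb_sum_spanned[OF assms] simp_thms)
qed

lemma module_hom_fdb_coord:
  "module_hom (lscale (fdb_sum N \<oplus>\<^sub>\<tau> (FdB :: ('k :: field_char_0, _) lie_alg))) (*) (fdb_coord N i)"
  unfolding module_hom_iff
proof (intro conjI)
  show "module (lscale (fdb_sum N \<oplus>\<^sub>\<tau> (FdB :: ('k, _) lie_alg)))"
    using bilinear_bracket_fdb_sum[of N] unfolding bilinear_bracket_def by (rule bilinear_overD)
qed (auto simp: fdb_coord_def lookup_add fdb_sum_scale module_mult)

lemma fdb_coord_basis: "fdb_coord N i (fdb_basis N j) = of_bool (i = j)"
proof -
  have "i = j" if "i div N = j div N" "i mod N = j mod N"
    using that by (metis mult_div_mod_eq)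
  then show ?thesis
    by (auto simp: fdb_coord_def fdb_basis_def lookup_single when_def dvd_eq_mod_eq_0)
qed

text \<open>With \<open>e\<^sub>k = (v k / N) X\<^bsup>N k\<^esup>\<close> one finds \<open>[e\<^sub>k, e\<^sub>l] = (k v k - l v l)/N X\<^bsup>N(k+l)\<^esup>\<close>,
  so the relation required of \<open>v\<close> is the one of the Faa di Bruno Lie algebra. The other vectors
  need no rescaling: if \<open>N\<close> does not divide \<open>i\<close>, then \<open>[X\<^sup>i, e\<^sub>l] = (i/N) X\<^bsup>i+N l\<^esup>\<close>
  for every choice of \<open>v\<close>.\<close>

lemma augmentation_isomorphic_fdb_sum:
  fixes B :: "nat \<Rightarrow> nat \<Rightarrow> 'k :: field_char_0 poly"
  assumes N: "N \<ge> 1" and v0: "\<And>k. k \<ge> 1 \<Longrightarrow> v k \<noteq> 0"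
    and v: "\<And>k l. of_nat k * v k - of_nat l * v l = (of_nat k - of_nat l) * v (k + l)"
    and B: "\<And>i j. \<lbrakk>i \<ge> 1; j \<ge> 1\<rbrakk> \<Longrightarrow>
      B i j = (if N dvd j then monom (of_nat i / v (j div N)) (i + j) else 0)"
  shows "augmentation_lie (poly_bilinear B) \<simeq>\<^sub>L fdb_sum N \<oplus>\<^sub>\<tau> FdB"
proof -
  define w where "w i = (if N dvd i then v (i div N) / of_nat N else 1)" for i
  have w: "w i \<noteq> 0" if "i \<ge> 1" for i
    using that N by (auto simp: w_def intro!: v0 elim!: dvdE)
  define \<beta> where "\<beta> i j = (if N dvd j then of_nat i / v (j div N) else 0)" for i j
  have rel: "w i * w j * (\<beta> i j - \<beta> j i) = fdb_coeff N i j * w (i + j)" if ij: "i \<ge> 1" "j \<ge> 1" for i j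
  proof (cases "N dvd i"; cases "N dvd j")
    assume *: "N dvd i" "N dvd j"
    then obtain k l where kl: "i = N * k" "j = N * l" by (auto elim!: dvdE)
    then have "v k \<noteq> 0" "v l \<noteq> 0" using ij by (auto intro!: v0)
    then have "w i * w j * (\<beta> i j - \<beta> j i) = (of_nat k * v k - of_nat l * v l) / of_nat N"
      using N by (simp add: w_def \<beta>_def kl field_simps)
    also have "\<dots> = (of_nat k - of_nat l) * (v (k + l) / of_nat N)" by (simp add: v)
    also have "of_nat k - of_nat l = (fdb_coeff N i j :: 'k)"
      using N by (simp add: fdb_coeff_def kl flip: right_diff_distrib)
    also have "v (k + l) / of_nat N = w (i + j)"
      using N by (simp add: w_def kl flip: distrib_left)
    finally show ?thesis .
  next
    assume *: "N dvd i" "\<not> N dvd j"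
    then have "\<not> N dvd i + j" by (simp add: dvd_add_right_iff)
    then show ?thesis
      using * w[OF ij(1)] N by (simp add: w_def \<beta>_def fdb_coeff_def)
  next
    assume *: "\<not> N dvd i" "N dvd j"
    then have "\<not> N dvd i + j" by (simp add: dvd_add_left_iff)
    then show ?thesis
      using * w[OF ij(2)] N by (simp add: w_def \<beta>_def fdb_coeff_def)
  qed (simp add: \<beta>_def fdb_coeff_def)
  show ?thesis
  proof (rule augmentation_isomorphic[OF _ graded_spanning_fdb_sum[OF N] w module_hom_fdb_coord fdb_coord_basis
        fdb_coeff_skew fdb_coeff_jacobi])
    show "graded_spanning (fdb_coeff N) (\<lambda>i. monom (w i) i) (augmentation_lie (poly_bilinear B))"
      by (rule graded_spanning_augmentation[OF _ w rel]) (auto simp: B \<beta>_def)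
  qed
qed

section \<open>The semidirect sum of the shift module\<close>

text \<open>The line acting by the shift is spanned by the basis vector of index \<open>N\<close>, the one index that
  the shift module leaves free.\<close>

definition shift_coeff :: "nat \<Rightarrow> nat \<Rightarrow> nat \<Rightarrow> 'k :: field_char_0" where
  "shift_coeff N i j = of_bool (j = N) - of_bool (i = N)"

text \<open>If \<open>\<gamma> j k\<close> is not zero, then \<open>j\<close> or \<open>k\<close> is \<open>N\<close>, and \<open>j + k\<close> is larger than \<open>N\<close>. The
  expression reduces to the cyclic sum of \<open>([j = N] - [k = N]) [i = N]\<close>, which telescopes.\<close>

lemma shift_coeff_jacobi:
  assumes "i \<ge> 1" "j \<ge> 1" "k \<ge> 1"
  shows "shift_coeff N j k * shift_coeff N i (j + k) + shift_coeff N k i * shift_coeff N j (k + i) +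
    shift_coeff N i j * shift_coeff N k (i + j) = 0"
  using assms by (auto simp: shift_coeff_def)

definition shift_basis :: "nat \<Rightarrow> nat \<Rightarrow> (nat \<Rightarrow>\<^sub>0 'k) \<times> 'k :: field_char_0" where
  "shift_basis N i = (if i = N then (0, 1) else (Poly_Mapping.single i 1, 0))"

definition shift_coord :: "nat \<Rightarrow> nat \<Rightarrow> (nat \<Rightarrow>\<^sub>0 'k) \<times> 'k :: field_char_0 \<Rightarrow> 'k" where
  "shift_coord N i = (\<lambda>(x, t). if i = N then t else Poly_Mapping.lookup x i)"

lemma shift_sum_scale:
  "lscale (shift_module N \<oplus>\<^sub>\<tau> line_lie) = (\<lambda>c (x, t). (free_scale c x, c * t))"
  by (simp add: semidirect_def shift_module_def line_lie_def)

lemma bilinear_shift_action: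
  "bilinear_over free_scale (*) free_scale (mact (shift_module N :: ('k :: field_char_0, _, _) right_mod))"
proof (rule bilinear_overI)
  fix x x' :: "nat \<Rightarrow>\<^sub>0 'k" and t t' c :: 'k
  show "mact (shift_module N) (x + x') t = mact (shift_module N) x t + mact (shift_module N) x' t"
    unfolding shift_module_def right_mod.simps
    by (rule sum_keys_add) (simp add: distrib_right single_add)
  show "mact (shift_module N) (free_scale c x) t = free_scale c (mact (shift_module N) x t)"
    unfolding shift_module_def right_mod.simps
    by (rule sum_keys_free_scale) (simp add: mult.assoc)
  show "mact (shift_module N) x (t + t') = mact (shift_module N) x t + mact (shift_module N) x t'"
    by (simp add: shift_module_def distrib_left single_add sum.distrib)
  show "mact (shift_module N) x (c * t) = free_scale c (mact (shift_module N) x t)"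
    by (simp add: shift_module_def free_scale_sum mult.left_commute)
qed (simp_all add: module_free_scale module_mult)

lemma bilinear_bracket_shift_sum:
  "bilinear_bracket (shift_module N \<oplus>\<^sub>\<tau> (line_lie :: ('k :: field_char_0, _) lie_alg))"
proof (rule bilinear_bracket_semidirect)
  show "bilinear_bracket (line_lie :: ('k, _) lie_alg)"
    unfolding bilinear_bracket_def by (rule bilinear_overI) (simp_all add: line_lie_def module_mult)
  show "bilinear_over (mscale (shift_module N)) (lscale line_lie) (mscale (shift_module N))
      (mact (shift_module N :: ('k, _, _) right_mod))"
    using bilinear_shift_action[of N] by (simp add: shift_module_def line_lie_def)
qed

lemma shift_sum_spanned:
  assumes "N \<ge> 1"
  shows "lspace (shift_module N \<oplus>\<^sub>\<tau> (line_lie :: ('k :: field_char_0, _) lie_alg)) =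
    module.span (lscale (shift_module N \<oplus>\<^sub>\<tau> line_lie)) (shift_basis N ` {1..})" (is "?V = _")
proof -
  let ?s = "lscale (shift_module N \<oplus>\<^sub>\<tau> (line_lie :: ('k, _) lie_alg))"
  interpret module ?s
    using bilinear_bracket_shift_sum[of N] unfolding bilinear_bracket_def by (rule bilinear_overD)
  have space: "?V = {x. Poly_Mapping.keys x \<subseteq> {1..} - {N}} \<times> UNIV"
    by (simp add: semidirect_def shift_module_def line_lie_def)
  have index: "{1..} - {N} = - {0, N}" by auto
  have mem: "(x, t) \<in> ?V \<longleftrightarrow> Poly_Mapping.lookup x 0 = 0 \<and> Poly_Mapping.lookup x N = 0" for x t
    unfolding space index by (auto simp: in_keys_iff subset_iff intro!: gr0I)
  show ?thesis
  proof
    have "subspace ?V"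
      unfolding subspace_def by (auto simp: mem lookup_add shift_sum_scale zero_prod_def)
    moreover have "shift_basis N ` {1..} \<subseteq> ?V"
      by (auto simp: shift_basis_def mem lookup_single when_def)
    ultimately show "span (shift_basis N ` {1..}) \<subseteq> ?V" by (intro span_minimal)
    have "(x, t) \<in> span (shift_basis N ` {1..})"
      if "Poly_Mapping.keys x \<subseteq> {1..} - {N}" for x :: "nat \<Rightarrow>\<^sub>0 'k" and t
    proof -
      from that have 1: "(x, 0) \<in> span (shift_basis N ` {1..})"
      proof (induction x rule: poly_mapping_closure)
        case zero
        show ?case using span_zero by (simp add: zero_prod_def)
      next
        case (add x x')
        from span_add[OF this] show ?case by simp
      next
        case (single k a)
        then have "(Poly_Mapping.single k a, 0) = ?s a (shift_basis N k)"
          by (simp add: shift_basis_def shift_sum_scale)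
        then show ?case
          using single by (simp only:) (intro span_scale span_base imageI, simp)
      qed
      have "(0, t) = ?s t (shift_basis N N)"
        by (auto simp: shift_basis_def shift_sum_scale intro!: poly_mapping_eqI)
      then have 2: "(0, t) \<in> span (shift_basis N ` {1..})"
        using assms by (simp only:) (intro span_scale span_base imageI, simp)
      show ?thesis using span_add[OF 1 2] by simp
    qed
    then show "?V \<subseteq> span (shift_basis N ` {1..})" by (auto simp: space)
  qed
qed

lemma graded_spanning_shift_sum:
  assumes "N \<ge> 1"
  shows "graded_spanning (shift_coeff N) (shift_basis N)
    (shift_module N \<oplus>\<^sub>\<tau> (line_lie :: ('k :: field_char_0, _) lie_alg))"
proof -
  let ?L = "shift_module N \<oplus>\<^sub>\<tau> (line_lie :: ('k, _) lie_alg)"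
  have "lbracket ?L (shift_basis N i) (shift_basis N j) =
      lscale ?L (shift_coeff N i j) (shift_basis N (i + j))" if "i \<ge> 1" "j \<ge> 1" for i j
    using that
    by (auto simp: shift_basis_def shift_coeff_def shift_sum_scale semidirect_def shift_module_def
        line_lie_def add.commute single_uminus intro!: poly_mapping_eqI)
  then show ?thesis
    unfolding graded_spanning_def
    by (intro conjI bilinear_bracket_shift_sum shift_sum_spanned[OF assms]) blast
qed

lemma module_hom_shift_coord:
  "module_hom (lscale (shift_module N \<oplus>\<^sub>\<tau> (line_lie :: ('k :: field_char_0, _) lie_alg))) (*) (shift_coord N i)"
  unfolding module_hom_iff
proof (intro conjI)
  show "module (lscale (shift_module N \<oplus>\<^sub>\<tau> (line_lie :: ('k, _) lie_alg)))"
    using bilinear_bracket_shift_sum[of N] unfolding bilinear_bracket_def by (rule bilinear_overD)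
qed (auto simp: shift_coord_def lookup_add shift_sum_scale module_mult)

lemma shift_coord_basis: "shift_coord N i (shift_basis N j) = of_bool (i = j)"
  by (auto simp: shift_coord_def shift_basis_def lookup_single when_def)

text \<open>The index \<open>2N\<close> is not reached from \<open>N\<close> by the shift, as \<open>X\<^sup>N\<close> commutes with itself. So the
  weight \<open>1/\<mu>\<close> at \<open>N\<close> can be prescribed without disturbing the recursion.\<close>

lemma augmentation_isomorphic_shift_sum:
  fixes B :: "nat \<Rightarrow> nat \<Rightarrow> 'k :: field_char_0 poly"
  assumes N: "N \<ge> 1" and mu: "\<mu> \<noteq> 0"
    and B: "\<And>i j. \<lbrakk>i \<ge> 1; j \<ge> 1\<rbrakk> \<Longrightarrow> B i j = (if j = N then monom (of_nat i * \<mu>) (i + N) else 0)"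
  shows "augmentation_lie (poly_bilinear B) \<simeq>\<^sub>L shift_module N \<oplus>\<^sub>\<tau> line_lie"
proof -
  \<comment> \<open>Away from \<open>N\<close>, the weight of \<open>i\<close> is the product of all smaller positive numbers in the
    residue class of \<open>i\<close> modulo \<open>N\<close>, so that a shift by \<open>N\<close> multiplies it by \<open>i\<close>.\<close>
  define below where "below i = {j\<in>{1..<i}. N dvd i - j}" for i
  define w where "w i = (if i = N then 1 / \<mu> else \<Prod>j\<in>below i. of_nat j)" for i
  have w: "w i \<noteq> 0" for i
    using mu by (auto simp: w_def below_def)
  have step: "w (i + N) = of_nat i * w i" if "i \<ge> 1" "i \<noteq> N" for i
  proof -
    have shift: "N dvd i + N - j \<longleftrightarrow> N dvd i - j" if "j \<le> i" for j
    proof -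
      have eq: "i + N - j = (i - j) + N" using that by simp
      show ?thesis unfolding eq by simp
    qed
    have "below (i + N) = insert i (below i)"
    proof (intro set_eqI iffI)
      fix j assume j: "j \<in> below (i + N)"
      show "j \<in> insert i (below i)"
      proof (cases "i < j")
        case True
        then have "0 < i + N - j" "i + N - j < N" using j by (auto simp: below_def)
        then show ?thesis using j by (auto simp: below_def dest: dvd_imp_le)
      next
        case False
        then show ?thesis using j shift[of j] by (auto simp: below_def)
      qed
    next
      fix j assume "j \<in> insert i (below i)"
      then show "j \<in> below (i + N)" using that N shift[of j] by (auto simp: below_def)
    qed
    moreover have "i \<notin> below i" "finite (below i)" by (auto simp: below_def)
    ultimately show ?thesis using that by (simp add: w_def)
  qed
  define \<beta> where "\<beta> i j = (if j = N then of_nat i * \<mu> else 0)" for i j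
  have wN: "w N = 1 / \<mu>" by (simp add: w_def)
  have rel: "w i * w j * (\<beta> i j - \<beta> j i) = shift_coeff N i j * w (i + j)" if ij: "i \<ge> 1" "j \<ge> 1" for i j
  proof (cases "i = N"; cases "j = N")
    assume "i = N" "j \<noteq> N"
    then show ?thesis
      using step[of j] ij mu by (simp add: \<beta>_def shift_coeff_def wN add.commute)
  next
    assume "i \<noteq> N" "j = N"
    then show ?thesis
      using step[of i] ij mu by (simp add: \<beta>_def shift_coeff_def wN)
  qed (simp_all add: \<beta>_def shift_coeff_def)
  show ?thesis
  proof (rule augmentation_isomorphic[OF _ graded_spanning_shift_sum[OF N] w module_hom_shift_coord
        shift_coord_basis _ shift_coeff_jacobi])
    show "graded_spanning (shift_coeff N) (\<lambda>i. monom (w i) i) (augmentation_lie (poly_bilinear B))"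
      by (rule graded_spanning_augmentation[OF _ w rel]) (auto simp: B \<beta>_def)
  qed (simp add: shift_coeff_def)
qed

section \<open>The four families\<close>

lemma abelian_augmentation:
  fixes B :: "nat \<Rightarrow> nat \<Rightarrow> 'k :: field_char_0 poly"
  assumes B: "\<And>i j. \<lbrakk>i \<ge> 1; j \<ge> 1\<rbrakk> \<Longrightarrow> B i j = 0"
  shows "abelian_lie_algebra (augmentation_lie (poly_bilinear B))"
proof -
  let ?L = "augmentation_lie (poly_bilinear B)"
  let ?X = "\<lambda>i. monom (1 :: 'k) i"
  have L: "graded_spanning (\<lambda>_ _. 0) ?X ?L"
    by (rule graded_spanning_augmentation[of B "\<lambda>_ _. 0"]) (simp_all add: B)
  then have space: "lspace ?L = module.span (lscale ?L) (?X ` {1..})"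
    and bil: "bilinear_over (lscale ?L) (lscale ?L) (lscale ?L) (lbracket ?L)"
    by (auto simp: graded_spanning_def bilinear_bracket_def)
  have "lbracket ?L x y = 0" if "x \<in> lspace ?L" "y \<in> lspace ?L" for x y
  proof (rule bilinear_over_eq_on_span[OF bil _ _ that[unfolded space]])
    show "bilinear_over (lscale ?L) (lscale ?L) (lscale ?L) (\<lambda>_ _. 0)"
      by (rule bilinear_overI)
        (simp_all add: bilinear_overD(1)[OF bil] module.scale_zero_right[OF bilinear_overD(1)[OF bil]])
    show "lbracket ?L x y = 0" if "x \<in> ?X ` {1..}" "y \<in> ?X ` {1..}" for x y
      using that by (auto simp: augmentation_lie_def poly_bilinear_monom B)
  qed
  moreover have "lie_algebra ?L" by (rule graded_spanning_lie_algebra[OF L]) simp_all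
  ultimately show ?thesis by (simp add: abelian_lie_algebra_def)
qed

theorem proposition3p5:
  fixes N :: nat and lam mu a b :: "'k :: field_char_0"
  shows
    "(N \<ge> 1 \<and> a \<noteq> 0 \<and> b \<notin> of_int ` {z. z < 0} \<longrightarrow>
        augmentation_lie (prelie1 N lam a b) \<simeq>\<^sub>L
          module_sum {1..<N} (\<lambda>r. FdB_module (of_nat r / of_nat N)) \<oplus>\<^sub>\<tau> FdB) \<and>
     (N \<ge> 1 \<and> mu \<noteq> 0 \<longrightarrow>
        augmentation_lie (prelie3 N lam mu) \<simeq>\<^sub>L
          module_sum {1..<N} (\<lambda>r. FdB_module (of_nat r / of_nat N)) \<oplus>\<^sub>\<tau> FdB) \<and>
     (N \<ge> 1 \<and> mu \<noteq> 0 \<longrightarrow>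
        augmentation_lie (prelie2 N lam mu) \<simeq>\<^sub>L shift_module N \<oplus>\<^sub>\<tau> line_lie) \<and>
     abelian_lie_algebra (augmentation_lie (prelie4 lam))"
proof (intro conjI impI; (elim conjE)?)
  assume N: "N \<ge> 1" and a: "a \<noteq> 0" and b: "b \<notin> of_int ` {z. z < 0}"
  have nonzero: "of_nat k + b \<noteq> 0" if "k \<ge> 1" for k
  proof
    assume "of_nat k + b = 0"
    then have "b = of_int (- int k)" by (simp add: eq_neg_iff_add_eq_0 add.commute)
    moreover have "- int k < 0" using that by simp
    ultimately show False using b by blast
  qed
  have quotient: "(of_nat j / of_nat N :: 'k) = of_nat (j div N)" if "N dvd j" for j
    using that N by (auto elim!: dvdE)
  show "augmentation_lie (prelie1 N lam a b) \<simeq>\<^sub>L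
      module_sum {1..<N} (\<lambda>r. FdB_module (of_nat r / of_nat N)) \<oplus>\<^sub>\<tau> FdB"
    unfolding fdb_sum_def[symmetric] prelie1_def
  proof (rule augmentation_isomorphic_fdb_sum[OF N, where v = "\<lambda>k. (of_nat k + b) / a"])
    show "(of_nat k + b) / a \<noteq> 0" if "k \<ge> 1" for k
      using nonzero[OF that] a by simp
    show "of_nat k * ((of_nat k + b) / a) - of_nat l * ((of_nat l + b) / a) =
        (of_nat k - of_nat l) * ((of_nat (k + l) + b) / a)" for k l
      using a by (simp add: field_simps)
  qed (auto simp: quotient mult.commute)
next
  assume "N \<ge> 1" "mu \<noteq> 0"
  then show "augmentation_lie (prelie3 N lam mu) \<simeq>\<^sub>L
      module_sum {1..<N} (\<lambda>r. FdB_module (of_nat r / of_nat N)) \<oplus>\<^sub>\<tau> FdB"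
    unfolding fdb_sum_def[symmetric] prelie3_def
    by (intro augmentation_isomorphic_fdb_sum[where v = "\<lambda>_. 1 / mu"]) (auto simp: field_simps)
next
  assume "N \<ge> 1" "mu \<noteq> 0"
  then show "augmentation_lie (prelie2 N lam mu) \<simeq>\<^sub>L shift_module N \<oplus>\<^sub>\<tau> line_lie"
    unfolding prelie2_def by (intro augmentation_isomorphic_shift_sum[where \<mu> = mu]) auto
next
  show "abelian_lie_algebra (augmentation_lie (prelie4 lam))"
    unfolding prelie4_def by (rule abelian_augmentation) simp
qed

end
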